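(* Let $v\in\mathbb{N}$ and let $a_1,\dots,a_m$ be distinct divisors of $v$ such that $\operatorname{lcm}(a_i,a_j)=v$ for all $i\ne j$. For $1\le i\le m$ define the binary sequence $X_i=(x_t)_{t=0}^{v-1}$ by $x_t=1$ if $t=la_i$ for some $0\le l\le\frac{v}{a_i}-1$, and $x_t=0$ otherwise. Then $\{X_1,\dots,X_m\}$ is a $(v,W,\Lambda,\lambda_c,R)$-VW-OOC with $N=m$ codewords, where $W=\{w_1,\dots,w_m\}$ with $w_i=\frac{v}{a_i}$, $r_i=\frac1m$ for each $i$, $\lambda_a(i)=\frac{v}{a_i}$, and $\lambda_c=1$.
   Context: Indices of sequences of length $v$ are taken modulo $v$. Let $\mathcal{C}=\{C_a:0\le a\le N-1\}$ be a set of $N$ binary sequences of length $v$, $C_a=(c_a(t))_{t=0}^{v-1}$. The autocorrelation of $C_a$ at shift $\delta$ ($1\le\delta\le v-1$) is $\sum_{t=0}^{v-1}c_a(t)c_a(t+\delta)$, and the cross-correlation of $C_a,C_b$ at shift $\delta$ ($0\le\delta\le v-1$) is $\sum_{t=0}^{v-1}c_a(t)c_b(t+\delta)$. Then $\mathcal{C}$ is a $(v,W,\Lambda,\lambda_c,R)$-VW-OOC with $W=\{w_1,\dots,w_m\}$, $\Lambda=\{\lambda_a(1),\dots,\lambda_a(m)\}$, $R=\{r_1,\dots,r_m\}$ if: (i) exactly $r_iN$ codewords have weight $w_i$ for $1\le i\le m$, where $r_1+\dots+r_m=1$ and $r_j\ge 0$; (ii) the autocorrelation of every codeword of weight $w_i$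 is at most $\lambda_a(i)$ at all nonzero shifts; (iii) the cross-correlation between any two distinct codewords is at most $\lambda_c$ at all shifts. *)

theory Defs
  imports Complex_Main
begin

text \<open>
  A sequence of length \<open>v\<close> is a list of length \<open>v\<close>, so that distinct codewords
  are distinct lists; the index reduction modulo \<open>v\<close> is explicit in the correlation.
\<close>

definition binary_seq :: "nat \<Rightarrow> nat list \<Rightarrow> bool" where
  "binary_seq v c \<longleftrightarrow> length c = v \<and> set c \<subseteq> {0, 1}"

definition weight :: "nat list \<Rightarrow> nat" where
  "weight c = count_list c 1"

definition cross_corr :: "nat \<Rightarrow> nat list \<Rightarrow> nat list \<Rightarrow> nat \<Rightarrow> nat" where
  "cross_corr v c d \<delta> = (\<Sum>t<v. c ! t * d ! ((t + \<delta>) mod v))"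

definition auto_corr :: "nat \<Rightarrow> nat list \<Rightarrow> nat \<Rightarrow> nat" where
  "auto_corr v c \<delta> = cross_corr v c c \<delta>"

text \<open>
  The parameters \<open>W\<close>, \<open>\<Lambda>\<close>, \<open>R\<close> are functions \<open>w\<close>, \<open>\<Lambda>\<close>, \<open>r\<close> on \<open>{1..m}\<close>: they are
  matched by index, and the entries of \<open>\<Lambda>\<close> and \<open>R\<close> may repeat. The weights
  \<open>w 1, \<dots>, w m\<close> are pairwise distinct; together with the ratios summing to 1 this
  forces every codeword to have one of these weights.
\<close>

definition vw_ooc ::
  "nat \<Rightarrow> nat \<Rightarrow> nat \<Rightarrow> (nat \<Rightarrow> nat) \<Rightarrow> (nat \<Rightarrow> nat) \<Rightarrow> nat \<Rightarrow> (nat \<Rightarrow> real) \<Rightarrow> nat list set \<Rightarrow> bool"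
where
  "vw_ooc v N m w \<Lambda> lc r C \<longleftrightarrow>
     finite C \<and> card C = N \<and> (\<forall>c\<in>C. binary_seq v c) \<and>
     inj_on w {1..m} \<and>
     (\<forall>i\<in>{1..m}. 0 \<le> r i) \<and> (\<Sum>i=1..m. r i) = 1 \<and>
     (\<forall>i\<in>{1..m}. real (card {c \<in> C. weight c = w i}) = r i * real N) \<and>
     (\<forall>i\<in>{1..m}. \<forall>c\<in>C. weight c = w i \<longrightarrow>
        (\<forall>\<delta>. 1 \<le> \<delta> \<and> \<delta> < v \<longrightarrow> auto_corr v c \<delta> \<le> \<Lambda> i)) \<and>
     (\<forall>c\<in>C. \<forall>d\<in>C. c \<noteq> d \<longrightarrow> (\<forall>\<delta><v. cross_corr v c d \<delta> \<le> lc))"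

definition multiples_seq :: "nat \<Rightarrow> nat \<Rightarrow> nat list" where
  "multiples_seq v a = map (\<lambda>t. if \<exists>l < v div a. t = l * a then 1 else 0) [0..<v]"

end

theory Submission imports Defs begin

text \<open>
  A coincidence of \<open>X\<^sub>i\<close> with the shift of \<open>X\<^sub>j\<close> by \<open>\<delta>\<close> is a position \<open>t\<close> with
  \<open>a\<^sub>i dvd t\<close> and \<open>a\<^sub>j dvd t + \<delta>\<close>. Two coincidences differ by a common multiple of \<open>a\<^sub>i\<close>
  and \<open>a\<^sub>j\<close>, that is, by a multiple of \<open>v\<close>, so there is at most one per period.
\<close>

text \<open>Links the indexing by \<open>l < v div a\<close> used in \<open>multiples_seq\<close> to
  plain divisibility: as \<open>a dvd v\<close>, the bounds \<open>l < v div a\<close> and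
  \<open>l * a < v\<close> agree.\<close>

lemma multiples_below_eq_image:
  fixes a v :: nat
  assumes "a dvd v" "a > 0"
  shows "{t. t < v \<and> a dvd t} = (\<lambda>l. l * a) ` {..<v div a}"
  using assms by (auto elim!: dvdE)

lemma card_multiples_below:
  fixes a v :: nat
  assumes "a dvd v" "a > 0"
  shows "card {t. t < v \<and> a dvd t} = v div a"
  using assms by (simp add: multiples_below_eq_image card_image inj_on_def)

lemma length_multiples_seq [simp]: "length (multiples_seq v a) = v"
  by (simp add: multiples_seq_def)

lemma binary_multiples_seq: "binary_seq v (multiples_seq v a)"
  by (auto simp: binary_seq_def multiples_seq_def)

lemma nth_multiples_seq:
  assumes "a dvd v" "a > 0" "t < v"
  shows "multiples_seq v a ! t = of_bool (a dvd t)"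
proof -
  have "(\<exists>l<v div a. t = l * a) \<longleftrightarrow> a dvd t"
    using multiples_below_eq_image[OF assms(1,2)] assms(3) by blast
  then show ?thesis
    using assms(3) by (simp add: multiples_seq_def)
qed

lemma weight_multiples_seq:
  assumes "a dvd v" "a > 0"
  shows "weight (multiples_seq v a) = v div a"
proof -
  have "weight (multiples_seq v a) = card {t. t < v \<and> multiples_seq v a ! t = 1}"
    by (simp add: weight_def count_list_eq_length_filter length_filter_conv_card eq_commute)
  also have "{t. t < v \<and> multiples_seq v a ! t = 1} = {t. t < v \<and> a dvd t}"
    using nth_multiples_seq[OF assms] by (auto simp: of_bool_def split: if_splits)
  finally show ?thesis
    by (simp add: card_multiples_below assms)
qed

text \<open>Because \<open>b dvd v\<close>, reducing \<open>t + \<delta>\<close> modulo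
  \<open>v\<close> does not affect divisibility by \<open>b\<close>, so the cyclic wrap-around
  disappears.\<close>

lemma cross_corr_multiples_seq:
  assumes "a dvd v" "a > 0" "b dvd v" "b > 0"
  shows "cross_corr v (multiples_seq v a) (multiples_seq v b) \<delta> =
    card {t. t < v \<and> a dvd t \<and> b dvd t + \<delta>}"
proof -
  have "cross_corr v (multiples_seq v a) (multiples_seq v b) \<delta> =
      (\<Sum>t<v. of_bool (a dvd t \<and> b dvd t + \<delta>))"
    unfolding cross_corr_def
    using assms by (intro sum.cong) (auto simp: nth_multiples_seq dvd_mod_iff)
  also have "\<dots> = card ({..<v} \<inter> {t. a dvd t \<and> b dvd t + \<delta>})"
    by (simp add: sum_of_bool_eq)
  also have "{..<v} \<inter> {t. a dvd t \<and> b dvd t + \<delta>} = {t. t < v \<and> a dvd t \<and> b dvd t + \<delta>}"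
    by auto
  finally show ?thesis .
qed

text \<open>Dropping the condition on \<open>t + \<delta>\<close> leaves the support of the
  sequence. The bound is attained when \<open>a dvd \<delta>\<close>.\<close>

lemma auto_corr_multiples_seq_le:
  assumes "a dvd v" "a > 0"
  shows "auto_corr v (multiples_seq v a) \<delta> \<le> v div a"
  unfolding auto_corr_def cross_corr_multiples_seq[OF assms assms]
    card_multiples_below[OF assms, symmetric]
  by (rule card_mono) auto

lemma cross_corr_multiples_seq_le_1:
  assumes "a dvd v" "a > 0" "b dvd v" "b > 0" and lcm: "lcm a b = v"
  shows "cross_corr v (multiples_seq v a) (multiples_seq v b) \<delta> \<le> 1"
proof -
  have le: "t \<le> s"
    if "t < v" "a dvd t" "b dvd t + \<delta>" "a dvd s" "b dvd s + \<delta>" for s t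
  proof -
    \<comment> \<open>Subtraction is truncated, so \<open>t - s\<close> is 0 when
      \<open>t \<le> s\<close>; otherwise it would be a positive multiple of \<open>v\<close> below
      \<open>v\<close>. Exchanging \<open>s\<close> and \<open>t\<close> later gives
      equality.\<close>
    have "a dvd t - s" "b dvd (t + \<delta>) - (s + \<delta>)"
      using that by (intro dvd_diff_nat; simp)+
    then have "v dvd t - s"
      using lcm by (auto intro: lcm_least)
    then show "t \<le> s"
      using \<open>t < v\<close> by (auto dest: dvd_imp_le)
  qed
  show ?thesis
    unfolding cross_corr_multiples_seq[OF assms(1-4)] One_nat_def
    by (subst card_le_Suc0_iff_eq) (auto intro!: antisym le)
qed

theorem theorem7p4:
  fixes v m :: nat and a :: "nat \<Rightarrow> nat"
  assumes "v \<ge> 1" and "m \<ge> 1"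
    and "inj_on a {1..m}"
    and "\<forall>i\<in>{1..m}. a i dvd v"
    and "\<forall>i\<in>{1..m}. \<forall>j\<in>{1..m}. i \<noteq> j \<longrightarrow> lcm (a i) (a j) = v"
  shows "vw_ooc v m m (\<lambda>i. v div a i) (\<lambda>i. v div a i) 1 (\<lambda>i. 1 / real m)
           ((\<lambda>i. multiples_seq v (a i)) ` {1..m})"
proof -
  let ?X = "\<lambda>i. multiples_seq v (a i)"
  have dvd: "a i dvd v" and pos: "a i > 0" if "i \<in> {1..m}" for i
    using assms(1,4) that by (force intro: Nat.gr0I)+
  have inj_w: "inj_on (\<lambda>i. v div a i) {1..m}"
  proof (rule inj_onI)
    fix i j assume i: "i \<in> {1..m}" and j: "j \<in> {1..m}" and eq: "v div a i = v div a j"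
    \<comment> \<open>Both products equal \<open>v\<close>; the positive common quotient can then be
      cancelled.\<close>
    have "v div a i * a i = v div a i * a j"
      using dvd[OF i] dvd[OF j] eq by (metis dvd_div_mult_self)
    moreover have "v div a i > 0"
      using dvd[OF i] pos[OF i] assms(1) by (simp add: div_greater_zero_iff dvd_imp_le)
    ultimately show "i = j"
      using assms(3) i j by (auto dest: inj_onD)
  qed
  have w: "weight (?X i) = v div a i" if "i \<in> {1..m}" for i
    using weight_multiples_seq[OF dvd pos] that by blast
  \<comment> \<open>The weight identifies the index. Hence the codewords are distinct, each weight
    class is a singleton, and the autocorrelation bound is the one for the right index.\<close>
  have w_eq: "weight (?X j) = v div a i \<longleftrightarrow> j = i" if "i \<in> {1..m}" "j \<in> {1..m}" for i j
    using inj_w that by (auto simp: w dest: inj_onD)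
  have inj_X: "inj_on ?X {1..m}"
    by (rule inj_onI) (metis w w_eq)
  have fibre: "{c \<in> ?X ` {1..m}. weight c = v div a i} = {?X i}" if "i \<in> {1..m}" for i
    using that w_eq[OF that] by blast
  have auto_le: "auto_corr v (?X j) \<delta> \<le> v div a i"
    if "i \<in> {1..m}" "j \<in> {1..m}" "weight (?X j) = v div a i" for i j \<delta>
    using auto_corr_multiples_seq_le[OF dvd pos] that w_eq by metis
  have cross_le: "cross_corr v (?X i) (?X j) \<delta> \<le> 1"
    if "i \<in> {1..m}" "j \<in> {1..m}" "?X i \<noteq> ?X j" for i j \<delta>
  proof -
    \<comment> \<open>Different codewords have different indices, so the lcm hypothesis
      applies.\<close>
    have "lcm (a i) (a j) = v"
      using assms(5) that by metis
    then show ?thesis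
      using cross_corr_multiples_seq_le_1 dvd pos that(1,2) by blast
  qed
  show ?thesis
    unfolding vw_ooc_def
  proof (intro conjI)
    show "card (?X ` {1..m}) = m"
      using card_image[OF inj_X] by simp
    show "\<forall>i\<in>{1..m}. real (card {c \<in> ?X ` {1..m}. weight c = v div a i}) = 1 / real m * real m"
      using fibre assms(2) by simp
    show "\<forall>i\<in>{1..m}. \<forall>c\<in>?X ` {1..m}. weight c = v div a i \<longrightarrow>
        (\<forall>\<delta>. 1 \<le> \<delta> \<and> \<delta> < v \<longrightarrow> auto_corr v c \<delta> \<le> v div a i)"
      using auto_le by blast
    show "\<forall>c\<in>?X ` {1..m}. \<forall>d\<in>?X ` {1..m}. c \<noteq> d \<longrightarrow> (\<forall>\<delta><v. cross_corr v c d \<delta> \<le> 1)"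
      using cross_le by blast
  qed (use assms(2) inj_w in \<open>auto simp: binary_multiples_seq\<close>)
qed

end
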